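(* Let $W,T\in\mathbb{R}^{n\times n}$ be symmetric positive definite and symmetric, respectively, and let $S=W^{-1}T$, with spectral radius $\rho(S)$. Then the optimal value of the relaxation parameter for the GSOR iterative method, that is, the value of $\alpha$ that minimizes $\rho(\mathcal{G}_\alpha)$ over $0<\alpha<\frac{2}{1+\rho(S)}$, is $$\alpha^*=\frac{2}{1+\sqrt{1+\rho(S)^2}},$$ and the corresponding optimal convergence factor is $$\rho(\mathcal{G}_{\alpha^*})=\min_{0<\alpha<\frac{2}{1+\rho(S)}}\rho(\mathcal{G}_\alpha)=1-\alpha^*=1-\frac{2}{1+\sqrt{1+\rho(S)^2}}.$$
   Context: For $0\neq\alpha\in\mathbb{R}$, the GSOR (generalized successive overrelaxation) method for the real system $\begin{pmatrix} W & -T\\ T & W\end{pmatrix}\begin{pmatrix} x \\ y \end{pmatrix}=\begin{pmatrix} p \\ q \end{pmatrix}$ with $p,q\in\mathbb{R}^n$ is the iteration, for $k=0,1,2,\dots$, $$W x^{(k+1)}=(1-\alpha)W x^{(k)}+\alpha T y^{(k)}+\alpha p,$$ $$W y^{(k+1)}=-\alpha T x^{(k+1)}+(1-\alpha)W y^{(k)}+\alpha q,$$ with initial approximations $x^{(0)},y^{(0)}\in\mathbb{R}^n$. Its iteration matrix is $$\mathcal{G}_\alpha=\begin{pmatrix} I & 0\\ \alpha S & I\end{pmatrix}^{-1}\begin{pmatrix}(1-\alpha)I & \alpha S\\ 0 & (1-\alpha)I\end{pmatrix},\qquad S=W^{-1}T,$$ where $I$ is the $n\times n$ identity matrix. The convergence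 factor of the method is the spectral radius $\rho(\mathcal{G}_\alpha)$. *)

theory Defs
  imports
    "Jordan_Normal_Form.Spectral_Radius"
    "Jordan_Normal_Form.Gauss_Jordan_Elimination"
    "Jordan_Normal_Form.Determinant"
begin

definition symmetric_mat :: "real mat \<Rightarrow> bool" where
  "symmetric_mat A \<longleftrightarrow> square_mat A \<and> transpose_mat A = A"

definition sym_pos_def_mat :: "real mat \<Rightarrow> bool" where
  "sym_pos_def_mat A \<longleftrightarrow> symmetric_mat A \<and>
     (\<forall>v \<in> carrier_vec (dim_row A). v \<noteq> 0\<^sub>v (dim_row A) \<longrightarrow> v \<bullet> (A *\<^sub>v v) > 0)"

(* The value is unspecified for singular or non-square matrices. *)
definition inverse_mat :: "real mat \<Rightarrow> real mat" where
  "inverse_mat A = the (mat_inverse A)"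

lemma inverse_mat:
  assumes A: "A \<in> carrier_mat n n" and det: "det A \<noteq> 0"
  shows "inverse_mat A \<in> carrier_mat n n"
    and "A * inverse_mat A = 1\<^sub>m n"
    and "inverse_mat A * A = 1\<^sub>m n"
proof -
  have "A \<in> Units (ring_mat TYPE(real) n ())"
    using det_non_zero_imp_unit[OF A det] .
  with mat_inverse(1)[OF A, of "()"] obtain B where B: "mat_inverse A = Some B"
    by fastforce
  from mat_inverse(2)[OF A B]
  show "inverse_mat A \<in> carrier_mat n n"
    and "A * inverse_mat A = 1\<^sub>m n"
    and "inverse_mat A * A = 1\<^sub>m n"
    by (simp_all add: inverse_mat_def B)
qed

(* Eigenvalues of a real matrix are taken over the complex numbers. *)
definition real_spectral_radius :: "real mat \<Rightarrow> real" where
  "real_spectral_radius A = spectral_radius (map_mat complex_of_real A)"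

(* Multiplying both update equations of the GSOR iteration by the inverse of W, with
   S = inverse_mat W * T, gives the iteration matrix for the stacked vector (x, y);
   the block lower triangular factor comes from using the new x in the update of y. *)
definition gsor_matrix :: "real mat \<Rightarrow> real \<Rightarrow> real mat" where
  "gsor_matrix S \<alpha> =
     (let n = dim_row S in
        inverse_mat (four_block_mat (1\<^sub>m n) (0\<^sub>m n n) (\<alpha> \<cdot>\<^sub>m S) (1\<^sub>m n)) *
        four_block_mat ((1 - \<alpha>) \<cdot>\<^sub>m 1\<^sub>m n) (\<alpha> \<cdot>\<^sub>m S) (0\<^sub>m n n) ((1 - \<alpha>) \<cdot>\<^sub>m 1\<^sub>m n))"

end

theory Submission
  imports Defs
begin

text \<open>
  An eigenvalue \<open>z\<close> of the GSOR matrix and an eigenvalue \<open>\<mu>\<close> of \<open>S\<close> are coupled by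
  \<open>(z - (1 - \<alpha>))\<^sup>2 = - z (\<alpha> \<mu>)\<^sup>2\<close>: multiplying \<open>G - z I\<close> by the unimodular lower triangular factor
  gives a block matrix with commuting blocks, whose determinant splits into two factors of the
  form \<open>det (c I \<plusminus> s S)\<close> (\<open>eigenvalue_gsor_matrix_iff\<close>). The eigenvalues of \<open>S\<close> are real because
  \<open>T v = \<mu> W v\<close> with \<open>W\<close> positive definite and \<open>T\<close> symmetric, so that the equation in \<open>z\<close> is the
  real quadratic \<open>z\<^sup>2 - (2 c - t) z + c\<^sup>2 = 0\<close> with \<open>c = 1 - \<alpha>\<close> and \<open>t = (\<alpha> \<mu>)\<^sup>2 \<ge> 0\<close>.

  Its roots have product \<open>c\<^sup>2\<close>, hence the spectral radius of the GSOR matrix is always at least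
  \<open>\<bar>1 - \<alpha>\<bar>\<close>. Its discriminant is \<open>t (t - 4 c)\<close>, so that both roots have modulus exactly \<open>c\<close> as long
  as \<open>t \<le> 4 c\<close>. The parameter \<open>\<alpha>\<^sup>*\<close> is the one with \<open>(\<alpha>\<^sup>* \<rho>)\<^sup>2 = 4 (1 - \<alpha>\<^sup>*)\<close>: there the
  discriminant of the largest \<open>\<bar>\<mu>\<bar>\<close> vanishes, and every eigenvalue has modulus \<open>1 - \<alpha>\<^sup>*\<close>.

  Every other parameter is strictly worse. If \<open>\<alpha> < \<alpha>\<^sup>*\<close> or \<open>\<alpha> > 2 - \<alpha>\<^sup>*\<close>, the lower bound
  \<open>\<bar>1 - \<alpha>\<bar>\<close> already exceeds \<open>1 - \<alpha>\<^sup>*\<close>. In the remaining range \<open>\<alpha>\<^sup>* < \<alpha> \<le> 2 - \<alpha>\<^sup>*\<close> the quadratic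
  that belongs to \<open>\<bar>\<mu>\<bar> = \<rho>\<close> is negative at \<open>- (1 - \<alpha>\<^sup>*)\<close>, which forces a real root to the left of
  that point.
\<close>

section \<open>Roots of the quadratic that couples the eigenvalues\<close>

text \<open>The two roots have product \<open>c\<^sup>2\<close>, so they cannot both be smaller than \<open>c\<close> in modulus.\<close>

lemma quadratic_root_norm_ge:
  fixes c t :: complex
  shows "\<exists>z. (z - c)\<^sup>2 = - z * t \<and> norm c \<le> norm z"
proof -
  define h where "h = t / 2 - c"
  define d where "d = csqrt (h\<^sup>2 - c\<^sup>2)"
  have d: "d\<^sup>2 = h\<^sup>2 - c\<^sup>2" by (simp add: d_def)
  define z1 where "z1 = - h + d"
  define z2 where "z2 = - h - d"
  have complete_square: "(z - c)\<^sup>2 + z * t = (z + h)\<^sup>2 - d\<^sup>2" for z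
    unfolding d by (simp add: h_def power2_eq_square algebra_simps)
  have root: "(z - c)\<^sup>2 = - z * t" if "(z + h)\<^sup>2 = d\<^sup>2" for z
    using complete_square[of z] that by (simp add: eq_neg_iff_add_eq_0)
  have r1: "(z1 - c)\<^sup>2 = - z1 * t" and r2: "(z2 - c)\<^sup>2 = - z2 * t"
    by (rule root; simp add: z1_def z2_def)+
  have "z1 * z2 = h\<^sup>2 - d\<^sup>2"
    by (simp add: z1_def z2_def power2_eq_square algebra_simps)
  hence "z1 * z2 = c\<^sup>2" by (simp add: d)
  hence "norm z1 * norm z2 = (norm c)\<^sup>2"
    by (metis norm_mult norm_power)
  hence "norm c \<le> norm z1 \<or> norm c \<le> norm z2"
    by (smt (verit) mult_strict_mono' norm_ge_zero power2_eq_square)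
  thus ?thesis using r1 r2 by blast
qed

text \<open>
  The condition on \<open>t\<close> says that the discriminant \<open>t (t - 4 c)\<close> is not positive: the roots are
  complex conjugates with product \<open>c\<^sup>2\<close>, or they coincide.
\<close>

lemma quadratic_root_norm_eq:
  fixes c t :: real and z :: complex
  assumes z: "(z - c)\<^sup>2 = - z * t" and t: "0 \<le> t" "t \<le> 4 * c"
  shows "norm z = c"
proof -
  define x y where "x = Re z" and "y = Im z"
  have re: "(x - c)\<^sup>2 - y\<^sup>2 = - x * t" and im: "2 * (x - c) * y = - y * t"
    using arg_cong[OF z, of Re] arg_cong[OF z, of Im]
    by (simp_all add: x_def y_def power2_eq_square algebra_simps)
  have "x\<^sup>2 + y\<^sup>2 = c\<^sup>2"
  proof (cases "y = 0")
    case True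
    have "(x - c + t / 2)\<^sup>2 = t * (t - 4 * c) / 4"
      using re True by (simp add: power2_eq_square algebra_simps)
    moreover have "t * (t - 4 * c) \<le> 0" using t by (simp add: mult_nonneg_nonpos)
    ultimately have eq: "x = c - t / 2" and "t * (t - 4 * c) = 0"
      by (smt (verit) divide_eq_0_iff zero_le_power2 zero_eq_power2 divide_nonpos_pos)+
    hence "t = 0 \<or> t = 4 * c" by simp
    thus ?thesis using eq True by (auto simp: power2_eq_square)
  next
    case False
    moreover have "y * (2 * (x - c) + t) = 0" using im by (simp add: algebra_simps)
    ultimately have "t = 2 * (c - x)" by simp
    thus ?thesis using re unfolding \<open>t = 2 * (c - x)\<close> by (simp add: power2_eq_square algebra_simps)
  qed
  moreover have "0 \<le> c" using t by simp
  ultimately show ?thesis by (simp add: cmod_def x_def y_def)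
qed

text \<open>
  The hypothesis says that the monic polynomial \<open>(r - c)\<^sup>2 + r t\<close> is negative at \<open>r = - m\<close>;
  as it tends to infinity on the left, it vanishes somewhere to the left of \<open>- m\<close>.
\<close>

lemma quadratic_real_root_less:
  fixes c t m :: real
  assumes neg: "(- m - c)\<^sup>2 < m * t"
  shows "\<exists>r < - m. (r - c)\<^sup>2 = - r * t"
proof -
  define h where "h = t / 2 - c"
  define D where "D = h\<^sup>2 - c\<^sup>2"
  have lt: "(h - m)\<^sup>2 < D"
    using neg unfolding h_def D_def by (simp add: power2_eq_square algebra_simps)
  hence D: "0 \<le> D" by (smt (verit) zero_le_power2)
  define r where "r = - h - sqrt D"
  have "(r - c)\<^sup>2 + r * t = (r + h)\<^sup>2 - D"
    unfolding h_def D_def by (simp add: power2_eq_square algebra_simps)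
  also have "\<dots> = 0" using D by (simp add: r_def)
  finally have "(r - c)\<^sup>2 = - r * t" by simp
  moreover have "\<bar>h - m\<bar> < sqrt D"
    using lt real_less_rsqrt[of "\<bar>h - m\<bar>" D] by simp
  hence "r < - m" unfolding r_def by linarith
  ultimately show ?thesis by blast
qed

section \<open>Real eigenvalues of a symmetric-definite pencil\<close>

lemma sym_pos_def_det_nonzero:
  assumes W: "W \<in> carrier_mat n n" and pd: "sym_pos_def_mat W"
  shows "det W \<noteq> 0"
proof
  assume "det W = 0"
  then obtain v where v: "v \<in> carrier_vec n" "v \<noteq> 0\<^sub>v n" "W *\<^sub>v v = 0\<^sub>v n"
    using det_0_iff_vec_prod_zero_field[OF W] by blast
  have "v \<bullet> (W *\<^sub>v v) > 0" using pd v(1,2) W unfolding sym_pos_def_mat_def by simp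
  thus False using v by simp
qed

lemma sym_scalar_prod:
  assumes A: "A \<in> carrier_mat n n" and sym: "symmetric_mat A"
    and u: "u \<in> carrier_vec n" and v: "v \<in> carrier_vec n"
  shows "u \<bullet> (A *\<^sub>v v) = v \<bullet> (A *\<^sub>v u)"
proof -
  have "u \<bullet> (A *\<^sub>v v) = (A *\<^sub>v u) \<bullet> v"
    using transpose_vec_mult_scalar[OF A v u] sym unfolding symmetric_mat_def by simp
  also have "\<dots> = v \<bullet> (A *\<^sub>v u)" using A u v by (intro comm_scalar_prod[of _ n]) auto
  finally show ?thesis .
qed

text \<open>
  Write an eigenvector as \<open>u + i w\<close> with real \<open>u\<close> and \<open>w\<close>. The real and imaginary parts of
  \<open>T v = \<mu> W v\<close>, paired with \<open>w\<close> and \<open>u\<close>, have the same left-hand side by symmetry of \<open>T\<close>;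
  their difference is \<open>Im \<mu>\<close> times the positive number \<open>u \<bullet> W u + w \<bullet> W w\<close>.
\<close>

lemma eigenvalue_inverse_mat_mult_real:
  assumes W: "W \<in> carrier_mat n n" and pd: "sym_pos_def_mat W"
    and T: "T \<in> carrier_mat n n" and sym: "symmetric_mat T"
    and ev: "eigenvalue (map_mat complex_of_real (inverse_mat W * T)) \<mu>"
  shows "\<mu> \<in> \<real>"
proof -
  define S where "S = inverse_mat W * T"
  note inv = inverse_mat[OF W sym_pos_def_det_nonzero[OF W pd]]
  have S: "S \<in> carrier_mat n n" using inv T by (simp add: S_def)
  have WS: "W * S = T"
    unfolding S_def using assoc_mult_mat[OF W inv(1) T] inv(2) T by simp
  obtain v where v: "v \<in> carrier_vec n" "v \<noteq> 0\<^sub>v n"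
    and Sv: "map_mat complex_of_real S *\<^sub>v v = \<mu> \<cdot>\<^sub>v v"
    using ev S unfolding eigenvalue_def eigenvector_def S_def[symmetric] by auto
  define u w where "u = map_vec Re v" and "w = map_vec Im v"
  have uw[simp]: "u \<in> carrier_vec n" "w \<in> carrier_vec n" "dim_vec u = n" "dim_vec w = n" using v by (auto simp: u_def w_def)
  have Su: "S *\<^sub>v u = Re \<mu> \<cdot>\<^sub>v u + (- Im \<mu>) \<cdot>\<^sub>v w"
  proof (rule eq_vecI)
    fix i assume "i < dim_vec (Re \<mu> \<cdot>\<^sub>v u + (- Im \<mu>) \<cdot>\<^sub>v w)"
    hence i: "i < n" using uw by simp
    have "Re ((map_mat complex_of_real S *\<^sub>v v) $ i) = Re ((\<mu> \<cdot>\<^sub>v v) $ i)" by (simp add: Sv)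
    thus "(S *\<^sub>v u) $ i = (Re \<mu> \<cdot>\<^sub>v u + (- Im \<mu>) \<cdot>\<^sub>v w) $ i"
      using i v S by (simp add: u_def w_def scalar_prod_def)
  qed (use S uw in auto)
  have Sw: "S *\<^sub>v w = Re \<mu> \<cdot>\<^sub>v w + Im \<mu> \<cdot>\<^sub>v u"
  proof (rule eq_vecI)
    fix i assume "i < dim_vec (Re \<mu> \<cdot>\<^sub>v w + Im \<mu> \<cdot>\<^sub>v u)"
    hence i: "i < n" using uw by simp
    have "Im ((map_mat complex_of_real S *\<^sub>v v) $ i) = Im ((\<mu> \<cdot>\<^sub>v v) $ i)" by (simp add: Sv)
    thus "(S *\<^sub>v w) $ i = (Re \<mu> \<cdot>\<^sub>v w + Im \<mu> \<cdot>\<^sub>v u) $ i"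
      using i v S by (simp add: u_def w_def scalar_prod_def)
  qed (use S uw in auto)
  have form: "a \<bullet> (T *\<^sub>v b) = r * (a \<bullet> (W *\<^sub>v b)) + s * (a \<bullet> (W *\<^sub>v d))"
    if "S *\<^sub>v b = r \<cdot>\<^sub>v b + s \<cdot>\<^sub>v d" and [simp]: "a \<in> carrier_vec n" "b \<in> carrier_vec n"
      "d \<in> carrier_vec n" for a b d r s
  proof -
    have "T *\<^sub>v b = W *\<^sub>v (S *\<^sub>v b)" unfolding WS[symmetric] by (rule assoc_mult_mat_vec[OF W S that(3)])
    also have "\<dots> = r \<cdot>\<^sub>v (W *\<^sub>v b) + s \<cdot>\<^sub>v (W *\<^sub>v d)"
      using W that by (simp add: mult_add_distrib_mat_vec[OF W] mult_mat_vec[OF W])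
    finally show ?thesis using W by (simp add: scalar_prod_add_distrib[of _ n])
  qed
  have "w \<bullet> (T *\<^sub>v u) = u \<bullet> (T *\<^sub>v w)" "w \<bullet> (W *\<^sub>v u) = u \<bullet> (W *\<^sub>v w)"
    using sym_scalar_prod[OF T sym] sym_scalar_prod[OF W] pd by (simp_all add: sym_pos_def_mat_def)
  hence "Im \<mu> * (u \<bullet> (W *\<^sub>v u) + w \<bullet> (W *\<^sub>v w)) = 0"
    using form[OF Su, of w] form[OF Sw, of u] by (simp add: algebra_simps)
  moreover have "u \<bullet> (W *\<^sub>v u) + w \<bullet> (W *\<^sub>v w) > 0"
  proof -
    have pos: "a \<bullet> (W *\<^sub>v a) \<ge> 0" "a \<noteq> 0\<^sub>v n \<Longrightarrow> a \<bullet> (W *\<^sub>v a) > 0"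
      if "a \<in> carrier_vec n" for a
      using pd W that unfolding sym_pos_def_mat_def by (cases "a = 0\<^sub>v n"; force)+
    have "u \<noteq> 0\<^sub>v n \<or> w \<noteq> 0\<^sub>v n"
    proof (rule ccontr)
      assume "\<not> ?thesis"
      hence "Re (v $ i) = 0 \<and> Im (v $ i) = 0" if "i < n" for i
        using that v unfolding u_def w_def by (metis carrier_vecD index_map_vec(1) index_zero_vec(1))
      hence "v = 0\<^sub>v n" using v by (intro eq_vecI) (auto simp: complex_eq_iff)
      thus False using v by simp
    qed
    thus ?thesis using pos[of u] pos[of w] by fastforce
  qed
  ultimately show ?thesis by (simp add: complex_is_Real_iff)
qed

section \<open>Eigenvalues of the GSOR matrix\<close>

lemma eigenvalue_iff_det:
  fixes A :: "'a :: field mat"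
  assumes A: "A \<in> carrier_mat n n"
  shows "eigenvalue A e \<longleftrightarrow> det (A - e \<cdot>\<^sub>m 1\<^sub>m n) = 0"
proof -
  have "char_matrix A e = A - e \<cdot>\<^sub>m 1\<^sub>m n"
    using A unfolding char_matrix_def by (intro eq_matI) auto
  thus ?thesis using eigenvalue_det[OF A] by simp
qed

text \<open>
  For \<open>s \<noteq> 0\<close> this is the definition of the eigenvalue \<open>c / s\<close>. The form without division also
  covers \<open>s = 0\<close>, where the existence of some complex eigenvalue is what makes it true.
\<close>

lemma det_smult_one_minus_smult_eq_0_iff:
  fixes S :: "complex mat"
  assumes S: "S \<in> carrier_mat n n" and n: "n > 0"
  shows "det (c \<cdot>\<^sub>m 1\<^sub>m n - s \<cdot>\<^sub>m S) = 0 \<longleftrightarrow> (\<exists>\<mu>. eigenvalue S \<mu> \<and> c = s * \<mu>)"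
proof (cases "s = 0")
  case True
  have "c \<cdot>\<^sub>m 1\<^sub>m n - s \<cdot>\<^sub>m S = c \<cdot>\<^sub>m 1\<^sub>m n" using S True by (intro eq_matI) auto
  moreover have "\<exists>\<mu>. eigenvalue S \<mu>" using spectrum_non_empty[OF S n] by (auto simp: spectrum_def)
  ultimately show ?thesis using n True by simp
next
  case False
  have "c \<cdot>\<^sub>m 1\<^sub>m n - s \<cdot>\<^sub>m S = (- s) \<cdot>\<^sub>m (S - (c / s) \<cdot>\<^sub>m 1\<^sub>m n)"
    using S False by (intro eq_matI) (auto simp: field_simps)
  hence "det (c \<cdot>\<^sub>m 1\<^sub>m n - s \<cdot>\<^sub>m S) = 0 \<longleftrightarrow> eigenvalue S (c / s)"
    using False by (simp add: eigenvalue_iff_det[OF S])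
  also have "\<dots> \<longleftrightarrow> (\<exists>\<mu>. eigenvalue S \<mu> \<and> c = s * \<mu>)" using False by (auto simp: field_simps)
  finally show ?thesis .
qed

text \<open>
  The blocks commute, so the determinant is \<open>det (c\<^sup>2 I - a b S\<^sup>2)\<close>, and with a complex square root
  \<open>s\<close> of \<open>a b\<close> the matrix factors as \<open>(c I - s S) (c I + s S)\<close>.
\<close>

lemma det_scalar_diagonal_blocks_eq_0_iff:
  fixes S :: "complex mat"
  assumes S: "S \<in> carrier_mat n n" and n: "n > 0"
  shows "det (four_block_mat (c \<cdot>\<^sub>m 1\<^sub>m n) (a \<cdot>\<^sub>m S) (b \<cdot>\<^sub>m S) (c \<cdot>\<^sub>m 1\<^sub>m n)) = 0
    \<longleftrightarrow> (\<exists>\<mu>. eigenvalue S \<mu> \<and> c\<^sup>2 = a * b * \<mu>\<^sup>2)"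
proof -
  define s where "s = csqrt (a * b)"
  have s: "s * s = a * b" unfolding s_def by (metis power2_csqrt power2_eq_square)
  let ?I = "1\<^sub>m n :: complex mat"
  have prod: "(p \<cdot>\<^sub>m ?I) * (q \<cdot>\<^sub>m ?I) = (p * q) \<cdot>\<^sub>m ?I"
    "(p \<cdot>\<^sub>m ?I) * (q \<cdot>\<^sub>m S) = (p * q) \<cdot>\<^sub>m S"
    "(p \<cdot>\<^sub>m S) * (q \<cdot>\<^sub>m ?I) = (p * q) \<cdot>\<^sub>m S"
    "(p \<cdot>\<^sub>m S) * (q \<cdot>\<^sub>m S) = (p * q) \<cdot>\<^sub>m (S * S)" for p q
    using S by (intro eq_matI; auto)+
  let ?P = "c \<cdot>\<^sub>m ?I - s \<cdot>\<^sub>m S" and ?Q = "c \<cdot>\<^sub>m ?I - (- s) \<cdot>\<^sub>m S"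
  have "?P * ?Q = (c \<cdot>\<^sub>m ?I) * ?Q - (s \<cdot>\<^sub>m S) * ?Q"
    using S by (intro minus_mult_distrib_mat) auto
  also have "(c \<cdot>\<^sub>m ?I) * ?Q = (c * c) \<cdot>\<^sub>m ?I - (c * - s) \<cdot>\<^sub>m S"
    unfolding prod(1,2)[symmetric] using S by (intro mult_minus_distrib_mat) auto
  also have "(s \<cdot>\<^sub>m S) * ?Q = (s * c) \<cdot>\<^sub>m S - (s * - s) \<cdot>\<^sub>m (S * S)"
    unfolding prod(3,4)[symmetric] using S by (intro mult_minus_distrib_mat) auto
  also have "(c * c) \<cdot>\<^sub>m ?I - (c * - s) \<cdot>\<^sub>m S - ((s * c) \<cdot>\<^sub>m S - (s * - s) \<cdot>\<^sub>m (S * S))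
      = (c * c) \<cdot>\<^sub>m ?I - (a * b) \<cdot>\<^sub>m (S * S)"
    using S unfolding s[symmetric] by (intro eq_matI) (auto simp: algebra_simps)
  finally have "?P * ?Q = (c * c) \<cdot>\<^sub>m ?I - (a * b) \<cdot>\<^sub>m (S * S)" .
  moreover have "det (?P * ?Q) = det ?P * det ?Q" using S by (intro det_mult) auto
  ultimately have "det (four_block_mat (c \<cdot>\<^sub>m ?I) (a \<cdot>\<^sub>m S) (b \<cdot>\<^sub>m S) (c \<cdot>\<^sub>m ?I))
      = det (c \<cdot>\<^sub>m ?I - s \<cdot>\<^sub>m S) * det (c \<cdot>\<^sub>m ?I - (- s) \<cdot>\<^sub>m S)"
    using S by (subst det_four_block_mat[of _ n]) (auto simp: prod)
  hence "det (four_block_mat (c \<cdot>\<^sub>m ?I) (a \<cdot>\<^sub>m S) (b \<cdot>\<^sub>m S) (c \<cdot>\<^sub>m ?I)) = 0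
      \<longleftrightarrow> (\<exists>\<mu>. eigenvalue S \<mu> \<and> (c = s * \<mu> \<or> c = - s * \<mu>))"
    using det_smult_one_minus_smult_eq_0_iff[OF S n, of c s]
      det_smult_one_minus_smult_eq_0_iff[OF S n, of c "- s"] by auto
  also have "\<dots> \<longleftrightarrow> (\<exists>\<mu>. eigenvalue S \<mu> \<and> c\<^sup>2 = a * b * \<mu>\<^sup>2)"
  proof -
    have "(s * \<mu>)\<^sup>2 = a * b * \<mu>\<^sup>2" for \<mu> using s by (simp add: power_mult_distrib power2_eq_square)
    thus ?thesis using power2_eq_iff[of c] by (metis minus_mult_left)
  qed
  finally show ?thesis .
qed

lemma
  assumes S: "S \<in> carrier_mat n n"
  shows gsor_matrix_carrier: "gsor_matrix S \<alpha> \<in> carrier_mat (n + n) (n + n)" (is ?carrier)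
    and lower_block_mult_gsor_matrix:
      "four_block_mat (1\<^sub>m n) (0\<^sub>m n n) (\<alpha> \<cdot>\<^sub>m S) (1\<^sub>m n) * gsor_matrix S \<alpha>
      = four_block_mat ((1 - \<alpha>) \<cdot>\<^sub>m 1\<^sub>m n) (\<alpha> \<cdot>\<^sub>m S) (0\<^sub>m n n) ((1 - \<alpha>) \<cdot>\<^sub>m 1\<^sub>m n)" (is "?L * _ = ?U")
proof -
  have G: "gsor_matrix S \<alpha> = inverse_mat ?L * ?U"
    using S by (simp add: gsor_matrix_def Let_def)
  have L: "?L \<in> carrier_mat (n + n) (n + n)" and U: "?U \<in> carrier_mat (n + n) (n + n)"
    using S by auto
  have "det ?L = 1"
    using S by (subst det_four_block_mat_upper_right_zero[of _ n _ n]) auto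
  hence inv: "inverse_mat ?L \<in> carrier_mat (n + n) (n + n)" "?L * inverse_mat ?L = 1\<^sub>m (n + n)"
    using inverse_mat[OF L] by auto
  show ?carrier unfolding G using inv U by simp
  show "?L * gsor_matrix S \<alpha> = ?U"
    unfolding G using assoc_mult_mat[OF L inv(1) U] inv(2) U by simp
qed

text \<open>
  Multiplying \<open>G - z I\<close> by the lower block factor, which has determinant 1, removes the inverse
  matrix without changing the determinant.
\<close>

lemma eigenvalue_gsor_matrix_iff:
  fixes \<alpha> :: real
  assumes S: "S \<in> carrier_mat n n" and n: "n > 0"
  shows "eigenvalue (map_mat complex_of_real (gsor_matrix S \<alpha>)) z \<longleftrightarrow>
    (\<exists>\<mu>. eigenvalue (map_mat complex_of_real S) \<mu> \<and>
         (z - complex_of_real (1 - \<alpha>))\<^sup>2 = - z * (complex_of_real \<alpha> * \<mu>)\<^sup>2)"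
proof -
  let ?a = "complex_of_real \<alpha>" and ?c = "complex_of_real (1 - \<alpha>)"
  let ?S = "map_mat complex_of_real S" and ?G = "map_mat complex_of_real (gsor_matrix S \<alpha>)"
  let ?L = "four_block_mat (1\<^sub>m n) (0\<^sub>m n n) (?a \<cdot>\<^sub>m ?S) (1\<^sub>m n)"
  let ?U = "four_block_mat (?c \<cdot>\<^sub>m 1\<^sub>m n) (?a \<cdot>\<^sub>m ?S) (0\<^sub>m n n) (?c \<cdot>\<^sub>m 1\<^sub>m n)"
  have cS: "?S \<in> carrier_mat n n" using S by simp
  have G: "?G \<in> carrier_mat (n + n) (n + n)" using gsor_matrix_carrier[OF S] by simp
  have L: "?L \<in> carrier_mat (n + n) (n + n)" using S by auto
  have "map_mat complex_of_real (four_block_mat (1\<^sub>m n) (0\<^sub>m n n) (\<alpha> \<cdot>\<^sub>m S) (1\<^sub>m n)) = ?L"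
    "map_mat complex_of_real (four_block_mat ((1 - \<alpha>) \<cdot>\<^sub>m 1\<^sub>m n) (\<alpha> \<cdot>\<^sub>m S) (0\<^sub>m n n) ((1 - \<alpha>) \<cdot>\<^sub>m 1\<^sub>m n)) = ?U"
    using S by (intro eq_matI; auto)+
  moreover have "map_mat complex_of_real (A * gsor_matrix S \<alpha>) = map_mat complex_of_real A * ?G"
    if "A \<in> carrier_mat (n + n) (n + n)" for A
    by (rule of_real_hom.mat_hom_mult[OF that gsor_matrix_carrier[OF S]])
  ultimately have LG: "?L * ?G = ?U"
    using lower_block_mult_gsor_matrix[OF S, of \<alpha>] S
    by (metis four_block_carrier_mat one_carrier_mat)
  have "?L * (?G - z \<cdot>\<^sub>m 1\<^sub>m (n + n)) = ?U - z \<cdot>\<^sub>m ?L"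
    using L G mult_smult_distrib[OF L one_carrier_mat, of z]
    by (subst mult_minus_distrib_mat[OF L G]) (auto simp: LG)
  also have "\<dots> = four_block_mat ((?c - z) \<cdot>\<^sub>m 1\<^sub>m n) (?a \<cdot>\<^sub>m ?S) ((- z * ?a) \<cdot>\<^sub>m ?S) ((?c - z) \<cdot>\<^sub>m 1\<^sub>m n)"
    (is "_ = ?M")
    using S by (intro eq_matI) auto
  finally have "det ?L * det (?G - z \<cdot>\<^sub>m 1\<^sub>m (n + n)) = det ?M"
    using det_mult[OF L minus_carrier_mat, of "z \<cdot>\<^sub>m 1\<^sub>m (n + n)" ?G] by simp
  moreover have "det ?L = 1"
    using S by (subst det_four_block_mat_upper_right_zero[of _ n _ n]) auto
  ultimately have "eigenvalue ?G z \<longleftrightarrow> det ?M = 0"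
    using eigenvalue_iff_det[OF G] by simp
  also have "\<dots> \<longleftrightarrow> (\<exists>\<mu>. eigenvalue ?S \<mu> \<and> (?c - z)\<^sup>2 = ?a * (- z * ?a) * \<mu>\<^sup>2)"
    by (rule det_scalar_diagonal_blocks_eq_0_iff[OF cS n])
  also have "\<dots> \<longleftrightarrow> (\<exists>\<mu>. eigenvalue ?S \<mu> \<and> (z - ?c)\<^sup>2 = - z * (?a * \<mu>)\<^sup>2)"
    by (simp add: power2_eq_square algebra_simps)
  finally show ?thesis .
qed

section \<open>Spectral radius of the GSOR matrix\<close>

lemma norm_le_real_spectral_radius:
  assumes "A \<in> carrier_mat n n" "n > 0" "eigenvalue (map_mat complex_of_real A) z"
  shows "norm z \<le> real_spectral_radius A"
  using spectral_radius_mem_max(2)[of "map_mat complex_of_real A" n] assms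
  by (auto simp: real_spectral_radius_def spectrum_def)

lemma real_spectral_radius_attained:
  assumes "A \<in> carrier_mat n n" "n > 0"
  obtains z where "eigenvalue (map_mat complex_of_real A) z" "norm z = real_spectral_radius A"
  using spectral_radius_mem_max(1)[of "map_mat complex_of_real A" n] assms
  by (auto simp: real_spectral_radius_def spectrum_def)

lemma real_spectral_radius_gsor_ge:
  assumes S: "S \<in> carrier_mat n n" and n: "n > 0"
  shows "\<bar>1 - \<alpha>\<bar> \<le> real_spectral_radius (gsor_matrix S \<alpha>)"
proof -
  obtain \<mu> where \<mu>: "eigenvalue (map_mat complex_of_real S) \<mu>"
    using real_spectral_radius_attained[OF S n] .
  obtain z where z: "(z - complex_of_real (1 - \<alpha>))\<^sup>2 = - z * (complex_of_real \<alpha> * \<mu>)\<^sup>2"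
    and "norm (complex_of_real (1 - \<alpha>)) \<le> norm z"
    using quadratic_root_norm_ge by blast
  moreover have "eigenvalue (map_mat complex_of_real (gsor_matrix S \<alpha>)) z"
    using eigenvalue_gsor_matrix_iff[OF S n] \<mu> z by blast
  hence "norm z \<le> real_spectral_radius (gsor_matrix S \<alpha>)"
    by (rule norm_le_real_spectral_radius[OF gsor_matrix_carrier[OF S]  add_pos_pos[OF n n]])
  ultimately show ?thesis by (simp only: norm_of_real)
qed

text \<open>
  Symmetry and definiteness enter the optimization only through the reality of the spectrum of
  \<open>S\<close>, which makes \<open>(\<alpha> \<mu>)\<^sup>2\<close> a nonnegative real number.
\<close>

locale gsor_real_spectrum =
  fixes S :: "real mat" and n :: nat
  assumes S: "S \<in> carrier_mat n n" and n: "n > 0"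
    and real_spectrum: "\<And>\<mu>. eigenvalue (map_mat complex_of_real S) \<mu> \<Longrightarrow> \<mu> \<in> \<real>"
begin

definition \<rho> where "\<rho> = real_spectral_radius S"
definition opt where "opt = 2 / (1 + sqrt (1 + \<rho>\<^sup>2))"

text \<open>
  The equation for \<open>opt * \<rho>\<close> is what characterizes the optimal parameter: for \<open>\<bar>\<mu>\<bar> = \<rho>\<close> the
  discriminant of the quadratic vanishes.
\<close>

lemma opt_range: "0 < opt" "opt \<le> 1" and opt_rho: "(opt * \<rho>)\<^sup>2 = 4 * (1 - opt)"
  and \<rho>_nonneg: "0 \<le> \<rho>" and opt_less: "opt < 2 / (1 + \<rho>)"
proof -
  define s where "s = sqrt (1 + \<rho>\<^sup>2)"
  have s: "1 \<le> s" "s\<^sup>2 = 1 + \<rho>\<^sup>2" unfolding s_def by simp_all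
  have o: "opt = 2 / (1 + s)" by (simp add: opt_def s_def)
  show "0 < opt" "opt \<le> 1" using s o by simp_all
  have "\<rho>\<^sup>2 = (s - 1) * (s + 1)" using s by (simp add: power2_eq_square algebra_simps)
  hence "(opt * \<rho>)\<^sup>2 = opt\<^sup>2 * ((s - 1) * (s + 1))" by (simp add: power_mult_distrib)
  also have "\<dots> = 4 * ((s - 1) / (s + 1))"
    using s(1) unfolding o by (simp add: power2_eq_square add.commute)
  also have "(s - 1) / (s + 1) = 1 - opt" using s(1) unfolding o by (simp add: field_simps)
  finally show "(opt * \<rho>)\<^sup>2 = 4 * (1 - opt)" .
  show r: "0 \<le> \<rho>"
    using real_spectral_radius_attained[OF S n] unfolding \<rho>_def by (metis norm_ge_zero)
  have "\<rho> < s" unfolding s_def using r by (simp add: real_less_rsqrt)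
  thus "opt < 2 / (1 + \<rho>)" using r unfolding o by (intro divide_strict_left_mono) auto
qed

text \<open>At the optimal parameter no eigenvalue \<open>\<mu>\<close> gives a positive discriminant, as \<open>\<bar>\<mu>\<bar> \<le> \<rho>\<close>.\<close>

lemma real_spectral_radius_gsor_opt: "real_spectral_radius (gsor_matrix S opt) = 1 - opt"
proof -
  note G = gsor_matrix_carrier[OF S, of opt]
  obtain z where z: "eigenvalue (map_mat complex_of_real (gsor_matrix S opt)) z"
    and radius: "norm z = real_spectral_radius (gsor_matrix S opt)"
    using real_spectral_radius_attained[OF G add_pos_pos[OF n n]] .
  from z obtain \<mu> where \<mu>: "eigenvalue (map_mat complex_of_real S) \<mu>"
    and eq: "(z - complex_of_real (1 - opt))\<^sup>2 = - z * (complex_of_real opt * \<mu>)\<^sup>2"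
    using eigenvalue_gsor_matrix_iff[OF S n] by blast
  from real_spectrum[OF \<mu>] obtain m where m: "\<mu> = complex_of_real m" by (auto elim: Reals_cases)
  have "\<bar>m\<bar> \<le> \<rho>" using norm_le_real_spectral_radius[OF S n \<mu>] by (simp add: m \<rho>_def)
  hence "\<bar>opt * m\<bar> \<le> \<bar>opt * \<rho>\<bar>"
    using opt_range \<rho>_nonneg by (simp add: abs_mult)
  hence "(opt * m)\<^sup>2 \<le> 4 * (1 - opt)" unfolding opt_rho[symmetric] by (simp only: abs_le_square_iff)
  moreover have "(z - complex_of_real (1 - opt))\<^sup>2 = - z * complex_of_real ((opt * m)\<^sup>2)"
    using eq by (simp add: m)
  ultimately have "norm z = 1 - opt" by (intro quadratic_root_norm_eq[of z _ "(opt * m)\<^sup>2"]) simp_all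
  thus ?thesis using radius by simp
qed

text \<open>
  Outside of \<open>opt < \<alpha> \<le> 2 - opt\<close> the bound \<open>\<bar>1 - \<alpha>\<bar>\<close> suffices. Inside, an eigenvalue of \<open>S\<close> of
  modulus \<open>\<rho>\<close> produces a negative real eigenvalue of the GSOR matrix beyond \<open>- (1 - opt)\<close>.
\<close>

lemma real_spectral_radius_gsor_greater:
  assumes \<alpha>: "\<alpha> \<noteq> opt"
  shows "1 - opt < real_spectral_radius (gsor_matrix S \<alpha>)"
proof (cases "opt < \<alpha> \<and> \<alpha> \<le> 2 - opt")
  case False
  hence "1 - opt < \<bar>1 - \<alpha>\<bar>" using \<alpha> by auto
  thus ?thesis using real_spectral_radius_gsor_ge[OF S n, of \<alpha>] by simp
next
  case True
  obtain \<mu> where \<mu>: "eigenvalue (map_mat complex_of_real S) \<mu>" and "norm \<mu> = \<rho>"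
    unfolding \<rho>_def using real_spectral_radius_attained[OF S n] .
  with real_spectrum[OF \<mu>] obtain m where m: "\<mu> = complex_of_real m" and "\<bar>m\<bar> = \<rho>"
    by (auto elim: Reals_cases)
  hence m2: "m\<^sup>2 = \<rho>\<^sup>2" by (metis power2_abs)
  \<comment> \<open>With \<open>t = (\<alpha> \<rho>)\<^sup>2\<close>, the square of \<open>q\<close> is \<open>(1 - opt) t\<close>, so that the quadratic takes the value
    \<open>(2 - opt - \<alpha>)\<^sup>2 - q\<^sup>2\<close> at \<open>- (1 - opt)\<close>.\<close>
  define q where "q = 2 * (1 - opt) * (\<alpha> / opt)"
  have pos: "0 < 1 - opt" using True by simp
  have "2 * (1 - opt) * 1 < q"
    unfolding q_def using True pos opt_range by (intro mult_strict_left_mono) simp_all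
  hence "\<bar>2 - opt - \<alpha>\<bar> < \<bar>q\<bar>" using True pos by simp
  hence "(2 - opt - \<alpha>)\<^sup>2 < q\<^sup>2" by (metis power2_abs abs_ge_zero power_strict_mono zero_less_numeral)
  also have "q\<^sup>2 = (1 - opt) * (4 * (1 - opt) * (\<alpha> / opt)\<^sup>2)"
    unfolding q_def power_mult_distrib by (simp add: power2_eq_square)
  also have "4 * (1 - opt) * (\<alpha> / opt)\<^sup>2 = (\<alpha> * m)\<^sup>2"
    using opt_range(1) unfolding opt_rho[symmetric] by (simp add: power_mult_distrib m2 power_divide)
  finally have "(- (1 - opt) - (1 - \<alpha>))\<^sup>2 < (1 - opt) * (\<alpha> * m)\<^sup>2"
    by (simp add: power2_eq_square algebra_simps)
  from quadratic_real_root_less[OF this] obtain r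
    where r: "r < - (1 - opt)" "(r - (1 - \<alpha>))\<^sup>2 = - r * (\<alpha> * m)\<^sup>2" by blast
  have "(complex_of_real r - complex_of_real (1 - \<alpha>))\<^sup>2
      = - complex_of_real r * (complex_of_real \<alpha> * \<mu>)\<^sup>2"
    using arg_cong[OF r(2), of complex_of_real] by (simp add: m)
  hence "eigenvalue (map_mat complex_of_real (gsor_matrix S \<alpha>)) (complex_of_real r)"
    using eigenvalue_gsor_matrix_iff[OF S n] \<mu> by blast
  from norm_le_real_spectral_radius[OF gsor_matrix_carrier[OF S] add_pos_pos[OF n n] this]
  show ?thesis using r(1) by simp
qed

end

theorem theorem2:
  fixes n :: nat and W T S :: "real mat" and \<rho> \<alpha>_opt :: real
  assumes "n \<ge> 1"
    and "W \<in> carrier_mat n n" and "sym_pos_def_mat W"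
    and "T \<in> carrier_mat n n" and "symmetric_mat T"
    and "S = inverse_mat W * T"
    and "\<rho> = real_spectral_radius S"
    and "\<alpha>_opt = 2 / (1 + sqrt (1 + \<rho>\<^sup>2))"
  shows "(\<forall>\<alpha>. is_arg_min (\<lambda>\<alpha>. real_spectral_radius (gsor_matrix S \<alpha>))
                (\<lambda>\<alpha>. 0 < \<alpha> \<and> \<alpha> < 2 / (1 + \<rho>)) \<alpha>
              \<longleftrightarrow> \<alpha> = \<alpha>_opt)
    \<and> real_spectral_radius (gsor_matrix S \<alpha>_opt) =
        (INF \<alpha>\<in>{0<..<2 / (1 + \<rho>)}. real_spectral_radius (gsor_matrix S \<alpha>))
    \<and> real_spectral_radius (gsor_matrix S \<alpha>_opt) = 1 - \<alpha>_opt
    \<and> 1 - \<alpha>_opt = 1 - 2 / (1 + sqrt (1 + \<rho>\<^sup>2))"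
proof -
  have S: "S \<in> carrier_mat n n"
    using inverse_mat(1)[OF assms(2) sym_pos_def_det_nonzero[OF assms(2,3)]] assms(4,6) by simp
  interpret G: gsor_real_spectrum S n
    using S assms(1) eigenvalue_inverse_mat_mult_real[OF assms(2-5)] assms(6)
    by unfold_locales auto
  have \<rho>: "G.\<rho> = \<rho>" and opt: "G.opt = \<alpha>_opt"
    by (simp_all add: G.\<rho>_def G.opt_def assms(7,8))
  let ?f = "\<lambda>\<alpha>. real_spectral_radius (gsor_matrix S \<alpha>)"
  have min: "?f \<alpha>_opt = 1 - \<alpha>_opt" and strict: "\<And>\<alpha>. \<alpha> \<noteq> \<alpha>_opt \<Longrightarrow> ?f \<alpha>_opt < ?f \<alpha>"
    using G.real_spectral_radius_gsor_opt G.real_spectral_radius_gsor_greater by (simp_all add: opt)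
  have le: "?f \<alpha>_opt \<le> ?f \<alpha>" for \<alpha> using strict[of \<alpha>] by (cases "\<alpha> = \<alpha>_opt") auto
  have range: "0 < \<alpha>_opt" "\<alpha>_opt < 2 / (1 + \<rho>)"
    using G.opt_range(1) G.opt_less by (simp_all add: opt \<rho>)
  have "is_arg_min ?f (\<lambda>\<alpha>. 0 < \<alpha> \<and> \<alpha> < 2 / (1 + \<rho>)) \<alpha> \<longleftrightarrow> \<alpha> = \<alpha>_opt" for \<alpha>
    using range strict le unfolding is_arg_min_def by (metis linorder_not_less)
  moreover have "(INF \<alpha>\<in>{0<..<2 / (1 + \<rho>)}. ?f \<alpha>) = ?f \<alpha>_opt"
    using range le by (intro cInf_eq_minimum) auto
  ultimately show ?thesis using min assms(8) by simp
qed

end
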